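(* For all non-negative integers $m$, $r$ and $k$, there is a bijection between the sets $\overline{\mathcal{F}}(m,r,k)$ and $\overline{\mathcal{M}}(m,r,k)$ (defined in the context).
   Context: Lattice paths use the steps $u=(1,1)$ (up), $d=(1,-1)$ (down) and $f=(1,0)$ (flat). A free Motzkin path of length $n$ is a path consisting of steps $u,d,f$ which starts at $(0,0)$ or at $(0,1)$ and ends at $(n,0)$ (there is no positivity requirement). A Motzkin prefix of length $n$ is a path of $n$ steps $u,d,f$ starting at $(0,0)$ and staying weakly above the $x$-axis, with no restriction on its endpoint. For non-negative integers $m,r,k$: $\mathcal{F}(m,r,k)$ is the set of free Motzkin paths of length $m+r$ with exactly $r$ flat steps that are contained in the strip $-\lfloor k/2\rfloor \le y \le \lfloor (k+1)/2\rfloor$; $\mathcal{M}(m,r,k)$ is the set of Motzkin prefixes of length $m+r$ with exactly $r$ flat steps contained in the strip $0\le y\le k$. Let $L_k$ be the line $y=\lfloor (k+1)/2\rfloor$ if $k$ is odd and the line $y=-\lfloor k/2\rfloor$ if $k$ is even. Then $\overline{\mathcal{F}}(m,r,k)$ is the set of paths in $\mathcal{F}(m,r,k)$ that touch (have a vertex on) the line $L_k$, and $\overline{\mathcal{M}}(m,r,k)$ is the set of paths in $\mathcal{M}(m,r,k)$ that touch the line $y=k$. *)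

theory Defs
  imports Main "HOL-Library.Product_Plus"
begin

datatype step = Up | Down | Flat

fun step_vec :: "step \<Rightarrow> int \<times> int" where
  "step_vec Up = (1, 1)"
| "step_vec Down = (1, -1)"
| "step_vec Flat = (1, 0)"

text \<open>A lattice path is given by its starting point together with its sequence of steps.
  Recording the starting point is essential: the same sequence of steps started at
  \<open>(0, 0)\<close> and at \<open>(0, 1)\<close> yields different paths.\<close>

type_synonym path = "(int \<times> int) \<times> step list"

fun vertices_from :: "int \<times> int \<Rightarrow> step list \<Rightarrow> (int \<times> int) list" where
  "vertices_from p [] = [p]"
| "vertices_from p (s # ss) = p # vertices_from (p + step_vec s) ss"

definition start_point :: "path \<Rightarrow> int \<times> int" where
  "start_point P = fst P"

definition steps :: "path \<Rightarrow> step list" where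
  "steps P = snd P"

definition vertices :: "path \<Rightarrow> (int \<times> int) list" where
  "vertices P = vertices_from (start_point P) (steps P)"

definition end_point :: "path \<Rightarrow> int \<times> int" where
  "end_point P = last (vertices P)"

definition path_length :: "path \<Rightarrow> nat" where
  "path_length P = length (steps P)"

definition num_flat :: "path \<Rightarrow> nat" where
  "num_flat P = count_list (steps P) Flat"

definition in_strip :: "int \<Rightarrow> int \<Rightarrow> path \<Rightarrow> bool" where
  "in_strip a b P \<longleftrightarrow> (\<forall>(x, y) \<in> set (vertices P). a \<le> y \<and> y \<le> b)"

definition touches_line :: "int \<Rightarrow> path \<Rightarrow> bool" where
  "touches_line c P \<longleftrightarrow> (\<exists>(x, y) \<in> set (vertices P). y = c)"

definition free_motzkin_path :: "nat \<Rightarrow> path \<Rightarrow> bool" where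
  "free_motzkin_path n P \<longleftrightarrow>
     path_length P = n \<and> start_point P \<in> {(0, 0), (0, 1)} \<and> end_point P = (int n, 0)"

definition motzkin_prefix :: "nat \<Rightarrow> path \<Rightarrow> bool" where
  "motzkin_prefix n P \<longleftrightarrow>
     path_length P = n \<and> start_point P = (0, 0) \<and> (\<forall>(x, y) \<in> set (vertices P). 0 \<le> y)"

definition free_motzkin_paths :: "nat \<Rightarrow> nat \<Rightarrow> nat \<Rightarrow> path set" where
  "free_motzkin_paths m r k =
     {P. free_motzkin_path (m + r) P \<and> num_flat P = r \<and>
         in_strip (- int (k div 2)) (int ((k + 1) div 2)) P}"

definition motzkin_prefixes :: "nat \<Rightarrow> nat \<Rightarrow> nat \<Rightarrow> path set" where
  "motzkin_prefixes m r k =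
     {P. motzkin_prefix (m + r) P \<and> num_flat P = r \<and> in_strip 0 (int k) P}"

definition L_line :: "nat \<Rightarrow> int" where
  "L_line k = (if odd k then int ((k + 1) div 2) else - int (k div 2))"

definition free_motzkin_paths_touching :: "nat \<Rightarrow> nat \<Rightarrow> nat \<Rightarrow> path set" where
  "free_motzkin_paths_touching m r k = {P \<in> free_motzkin_paths m r k. touches_line (L_line k) P}"

definition motzkin_prefixes_touching :: "nat \<Rightarrow> nat \<Rightarrow> nat \<Rightarrow> path set" where
  "motzkin_prefixes_touching m r k = {P \<in> motzkin_prefixes m r k. touches_line (int k) P}"

end

theory Submission
  imports Defs
begin

text \<open>The paths of a family for \<open>k\<close> that miss the distinguished line are exactly the paths of the
  family for \<open>k - 1\<close>, so it suffices to count the families without the touching condition.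
  Let \<open>W(i, j)\<close> be the number of walks from height \<open>i\<close> to height \<open>j\<close> with given length and number
  of flat steps inside the strip \<open>1 \<le> y \<le> N\<close>, where \<open>N = k + 1\<close>. Decomposing by the first and by
  the last step yields \<open>W(i - 1, j) + W(i + 1, j) = W(i, j - 1) + W(i, j + 1)\<close>, whence
  \<open>W(i, j) = W(i - 1, j - 1) + W(1, i + j - 1)\<close>. Telescoping along two adjacent diagonals gives
  \<open>W(c, c) + W(c + 1, c) = W(1, 1) + \<dots> + W(1, 2c)\<close>. For \<open>c = k div 2 + 1\<close>, after a vertical shift,
  the left side counts free Motzkin paths and the right side counts Motzkin prefixes.\<close>

section \<open>Walks in a strip\<close>

text \<open>Every step advances x by one, so a path with known start is determined by its heights
  alone.\<close>

fun heights :: "int \<Rightarrow> step list \<Rightarrow> int list" where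
  "heights y [] = [y]"
| "heights y (s # ss) = y # heights (y + snd (step_vec s)) ss"

lemma heights_not_Nil [simp]: "heights y ss \<noteq> []"
  by (cases ss) auto

lemma heights_start: "y \<in> set (heights y ss)"
  by (cases ss) auto

lemma last_heights_in: "set (heights y ss) \<subseteq> A \<Longrightarrow> last (heights y ss) \<in> A"
  using last_in_set[OF heights_not_Nil] by blast

lemma heights_shift: "heights (y + c) ss = map (\<lambda>h. h + c) (heights y ss)"
proof (induction ss arbitrary: y)
  case (Cons s ss)
  from Cons[of "y + snd (step_vec s)"] show ?case by (simp add: algebra_simps)
qed simp

lemma heights_snoc:
  "heights y (ss @ [s]) = heights y ss @ [last (heights y ss) + snd (step_vec s)]"
  by (induction ss arbitrary: y) auto

definition walks :: "int \<Rightarrow> int \<Rightarrow> nat \<Rightarrow> nat \<Rightarrow> int \<Rightarrow> int \<Rightarrow> step list set" where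
  "walks a b n r i j = {ss. length ss = n \<and> count_list ss Flat = r \<and>
     set (heights i ss) \<subseteq> {a..b} \<and> last (heights i ss) = j}"

definition walk_count :: "int \<Rightarrow> int \<Rightarrow> nat \<Rightarrow> nat \<Rightarrow> int \<Rightarrow> int \<Rightarrow> nat" where
  "walk_count a b n r i j = card (walks a b n r i j)"

lemma finite_step_lists: "finite {ss :: step list. length ss = n}"
proof -
  have "(UNIV :: step set) = {Up, Down, Flat}"
    using step.exhaust by auto
  then have "finite (UNIV :: step set)"
    by (metis finite.emptyI finite_insert)
  from finite_lists_length_eq[OF this, of n] show ?thesis
    by simp
qed

lemma finite_walks [simp]: "finite (walks a b n r i j)"
  by (rule finite_subset[OF _ finite_step_lists[of n]]) (auto simp: walks_def)

lemma walks_start_outside: "i \<notin> {a..b} \<Longrightarrow> walks a b n r i j = {}"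
  using heights_start[of i] by (fastforce simp: walks_def)

lemma walks_end_outside: "j \<notin> {a..b} \<Longrightarrow> walks a b n r i j = {}"
  using last_heights_in[of i _ "{a..b}"] by (auto simp: walks_def)

lemma walk_count_start_outside: "i \<notin> {a..b} \<Longrightarrow> walk_count a b n r i j = 0"
  by (simp add: walk_count_def walks_start_outside)

lemma walk_count_end_outside: "j \<notin> {a..b} \<Longrightarrow> walk_count a b n r i j = 0"
  by (simp add: walk_count_def walks_end_outside)

text \<open>Step lists record no absolute height, so both sides count the very same set of
  lists.\<close>

lemma walk_count_shift:
  "walk_count (a + c) (b + c) n r (i + c) (j + c) = walk_count a b n r i j"
proof -
  have "walks (a + c) (b + c) n r (i + c) (j + c) = walks a b n r i j"
    by (auto simp: walks_def heights_shift last_map subset_iff)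
  then show ?thesis
    by (simp add: walk_count_def)
qed

text \<open>Serves the two step recurrences: walks split into three classes by the step removed,
  each an injective image of a set of shorter walks.\<close>

lemma card_Un_images_3:
  assumes "inj f" "inj g" "inj h" "finite A" "finite B" "finite C"
    and "f ` A \<inter> g ` B = {}" "f ` A \<inter> h ` C = {}" "g ` B \<inter> h ` C = {}"
  shows "card (f ` A \<union> g ` B \<union> h ` C) = card A + card B + card C"
proof -
  have "card (f ` A \<union> g ` B \<union> h ` C) = card (f ` A) + card (g ` B) + card (h ` C)"
    using assms by (subst card_Un_disjoint; auto simp: card_Un_disjoint)+
  then show ?thesis
    using assms by (simp add: card_image inj_on_subset[OF _ subset_UNIV])
qed

text \<open>Heights just beyond the strip contribute 0, so its edges need no separate cases; only
  the vertex \<open>i\<close> that is split off has to lie in the strip.\<close>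

lemma walk_count_first_step:
  assumes "i \<in> {a..b}"
  shows "walk_count a b (Suc n) r i j = walk_count a b n r (i + 1) j + walk_count a b n r (i - 1) j
    + (if r = 0 then 0 else walk_count a b n (r - 1) i j)"
proof -
  \<comment> \<open>The case \<open>r = 0\<close> is separate because \<open>0 - 1 = 0\<close> on
    naturals would wrongly admit walks without flat steps.\<close>
  define F where "F = (if r = 0 then {} else walks a b n (r - 1) i j)"
  have "walks a b (Suc n) r i j =
      Cons Up ` walks a b n r (i + 1) j \<union> Cons Down ` walks a b n r (i - 1) j \<union> Cons Flat ` F"
    (is "?L = ?R")
  proof (rule set_eqI)
    fix ss
    show "ss \<in> ?L \<longleftrightarrow> ss \<in> ?R"
    proof (cases ss)
      case (Cons s ss')
      then show ?thesis
        using assms by (cases s) (auto simp: walks_def F_def image_iff)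
    qed (auto simp: walks_def)
  qed
  moreover have "finite F"
    by (simp add: F_def)
  ultimately have "card ?L = card (walks a b n r (i + 1) j) + card (walks a b n r (i - 1) j) + card F"
    by (simp only:) (rule card_Un_images_3; auto)
  then show ?thesis
    by (simp add: walk_count_def F_def)
qed

lemma walk_count_last_step:
  assumes "j \<in> {a..b}"
  shows "walk_count a b (Suc n) r i j = walk_count a b n r i (j + 1) + walk_count a b n r i (j - 1)
    + (if r = 0 then 0 else walk_count a b n (r - 1) i j)"
proof -
  define F where "F = (if r = 0 then {} else walks a b n (r - 1) i j)"
  have "walks a b (Suc n) r i j =
      (\<lambda>ss. ss @ [Down]) ` walks a b n r i (j + 1) \<union> (\<lambda>ss. ss @ [Up]) ` walks a b n r i (j - 1)
      \<union> (\<lambda>ss. ss @ [Flat]) ` F"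
    (is "?L = ?R")
  proof (rule set_eqI)
    fix ss
    show "ss \<in> ?L \<longleftrightarrow> ss \<in> ?R"
    proof (cases ss rule: rev_cases)
      case (snoc ss' s)
      then show ?thesis
        using assms by (cases s) (auto simp: walks_def F_def image_iff heights_snoc)
    qed (auto simp: walks_def)
  qed
  moreover have "finite F"
    by (simp add: F_def)
  ultimately have "card ?L = card (walks a b n r i (j + 1)) + card (walks a b n r i (j - 1)) + card F"
    by (simp only:) (rule card_Un_images_3; auto simp: inj_def)
  then show ?thesis
    by (simp add: walk_count_def F_def)
qed

text \<open>A flat step changes neither end, so the flat terms of the two recurrences agree and
  cancel. In matrix terms, walk counts commute with the adjacency matrix of the path graph on
  \<open>{a..b}\<close>.\<close>

lemma walk_count_commute:
  assumes "i \<in> {a..b}" "j \<in> {a..b}"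
  shows "walk_count a b n r (i + 1) j + walk_count a b n r (i - 1) j =
    walk_count a b n r i (j + 1) + walk_count a b n r i (j - 1)"
  using walk_count_first_step[OF assms(1), of n r j] walk_count_last_step[OF assms(2), of n r i]
  by simp

text \<open>By commutation, W(i, j) - W(i - 1, j - 1) is constant along each antidiagonal; its value
  is read off at i = 1, where W(0, j - 1) = 0. The bound on \<open>i + j\<close> keeps the points
  where commutation is applied inside the strip.\<close>

lemma walk_count_diagonal:
  assumes "1 \<le> i" "1 \<le> j" "i + j \<le> N + 2"
  shows "walk_count 1 N n r i j = walk_count 1 N n r (i - 1) (j - 1) + walk_count 1 N n r 1 (i + j - 1)"
  using assms
proof (induction i arbitrary: j rule: int_ge_induct)
  case base
  then show ?case by (simp add: walk_count_start_outside)
next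
  case (step i)
  have "walk_count 1 N n r i (j + 1) = walk_count 1 N n r (i - 1) j + walk_count 1 N n r 1 (i + j)"
    using step.IH[of "j + 1"] step.prems by (simp add: algebra_simps)
  moreover have "walk_count 1 N n r (i + 1) j + walk_count 1 N n r (i - 1) j =
      walk_count 1 N n r i (j + 1) + walk_count 1 N n r i (j - 1)"
    using step by (intro walk_count_commute) auto
  ultimately show ?case
    by (simp add: algebra_simps)
qed

text \<open>The diagonal through (c, c) collects the odd \<open>l\<close>, the one through (c + 1,
  c) the even \<open>l\<close>. Both begin with walks ending at height 0, outside the strip.\<close>

lemma walk_count_central:
  assumes "2 * int c \<le> N + 1"
  shows "walk_count 1 N n r (int c) (int c) + walk_count 1 N n r (int c + 1) (int c) =
    (\<Sum>l = 1..2 * int c. walk_count 1 N n r 1 l)"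
  using assms
proof (induction c)
  case 0
  then show ?case by (simp add: walk_count_end_outside)
next
  case (Suc c)
  have "{1..2 * int (Suc c)} = insert (2 * int c + 2) (insert (2 * int c + 1) {1..2 * int c})"
    by auto
  moreover have "walk_count 1 N n r (int c + 1) (int c + 1) =
      walk_count 1 N n r (int c) (int c) + walk_count 1 N n r 1 (2 * int c + 1)"
    using walk_count_diagonal[of "int c + 1" "int c + 1" N n r] Suc.prems
    by (simp add: algebra_simps)
  moreover have "walk_count 1 N n r (int c + 2) (int c + 1) =
      walk_count 1 N n r (int c + 1) (int c) + walk_count 1 N n r 1 (2 * int c + 2)"
    using walk_count_diagonal[of "int c + 2" "int c + 1" N n r] Suc.prems
    by (simp add: algebra_simps)
  ultimately show ?case
    using Suc by (simp add: algebra_simps)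
qed

section \<open>Counting free Motzkin paths and Motzkin prefixes\<close>

lemma map_snd_vertices_from: "map snd (vertices_from p ss) = heights (snd p) ss"
  by (induction ss arbitrary: p) (auto simp: snd_add)

lemma vertices_from_not_Nil [simp]: "vertices_from p ss \<noteq> []"
  by (cases ss) auto

text \<open>The length forces the final x-coordinate, so ending at (n, 0) becomes a condition on the
  last height.\<close>

lemma last_vertices_from:
  "last (vertices_from p ss) = (fst p + int (length ss), last (heights (snd p) ss))"
proof (rule prod_eqI)
  have "fst (step_vec s) = 1" for s
    by (cases s) auto
  then show "fst (last (vertices_from p ss)) = fst (fst p + int (length ss), last (heights (snd p) ss))"
    by (induction ss arbitrary: p) (auto simp: fst_add)
  show "snd (last (vertices_from p ss)) = snd (fst p + int (length ss), last (heights (snd p) ss))"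
    by (simp add: map_snd_vertices_from[symmetric] last_map)
qed

lemma in_strip_iff: "in_strip a b P \<longleftrightarrow> set (heights (snd (fst P)) (snd P)) \<subseteq> {a..b}"
  by (auto simp: in_strip_def vertices_def start_point_def steps_def
      map_snd_vertices_from[symmetric] subset_iff image_iff)

lemma free_motzkin_paths_eq:
  "free_motzkin_paths m r k =
     Pair (0, 0) ` walks (- int (k div 2)) (int ((k + 1) div 2)) (m + r) r 0 0 \<union>
     Pair (0, 1) ` walks (- int (k div 2)) (int ((k + 1) div 2)) (m + r) r 1 0"
  by (auto simp: free_motzkin_paths_def free_motzkin_path_def in_strip_iff walks_def path_length_def
      num_flat_def end_point_def vertices_def start_point_def steps_def last_vertices_from)

lemma motzkin_prefixes_eq:
  "motzkin_prefixes m r k = Pair (0, 0) ` (\<Union>j\<in>{0..int k}. walks 0 (int k) (m + r) r 0 j)"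
proof -
  have nonneg: "0 \<le> y" if "in_strip 0 b P" "(x, y) \<in> set (vertices P)" for b P x y
    using that by (auto simp: in_strip_def)
  have "motzkin_prefixes m r k = {P. length (snd P) = m + r \<and> fst P = (0, 0) \<and>
      count_list (snd P) Flat = r \<and> in_strip 0 (int k) P}"
    using nonneg
    by (auto simp: motzkin_prefixes_def motzkin_prefix_def path_length_def num_flat_def
        start_point_def steps_def)
  also have "\<dots> = Pair (0, 0) ` (\<Union>j\<in>{0..int k}. walks 0 (int k) (m + r) r 0 j)"
    using last_heights_in[of 0 _ "{0..int k}"] by (auto simp: in_strip_iff walks_def)
  finally show ?thesis .
qed

lemma finite_free_motzkin_paths: "finite (free_motzkin_paths m r k)"
  by (simp add: free_motzkin_paths_eq)

lemma finite_motzkin_prefixes: "finite (motzkin_prefixes m r k)"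
  by (simp add: motzkin_prefixes_eq)

lemma card_free_motzkin_paths:
  fixes k :: nat
  defines "c \<equiv> int (k div 2) + 1"
  shows "card (free_motzkin_paths m r k) =
    walk_count 1 (int k + 1) (m + r) r c c + walk_count 1 (int k + 1) (m + r) r (c + 1) c"
proof -
  let ?a = "- int (k div 2)" and ?b = "int ((k + 1) div 2)"
  have "card (free_motzkin_paths m r k) =
      walk_count ?a ?b (m + r) r 0 0 + walk_count ?a ?b (m + r) r 1 0"
    unfolding free_motzkin_paths_eq walk_count_def
    by (subst card_Un_disjoint) (auto simp: card_image inj_on_def)
  \<comment> \<open>Shifting by \<open>c\<close> moves the lower edge to 1 and the x-axis to height
    \<open>c\<close>; the upper edge lands on k + 1 because the two floors add up to k.\<close>
  moreover have "?a + c = 1" "?b + c = int k + 1"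
    by (auto simp: c_def)
  ultimately show ?thesis
    using walk_count_shift[of ?a c ?b "m + r" r 0 0] walk_count_shift[of ?a c ?b "m + r" r 1 0]
    by (simp add: add.commute)
qed

text \<open>Prefixes are classified by their final height, then raised by 1 into the strip used for
  the free paths.\<close>

lemma card_motzkin_prefixes:
  "card (motzkin_prefixes m r k) = (\<Sum>l = 1..int k + 1. walk_count 1 (int k + 1) (m + r) r 1 l)"
proof -
  have "card (motzkin_prefixes m r k) = card (\<Union>j\<in>{0..int k}. walks 0 (int k) (m + r) r 0 j)"
    unfolding motzkin_prefixes_eq by (rule card_image) (auto simp: inj_on_def)
  also have "\<dots> = (\<Sum>j\<in>{0..int k}. walk_count 0 (int k) (m + r) r 0 j)"
    unfolding walk_count_def by (rule card_UN_disjoint) (simp_all, auto simp: walks_def)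
  also have "\<dots> = (\<Sum>l\<in>{1..int k + 1}. walk_count 1 (int k + 1) (m + r) r 1 l)"
  proof (rule sum.reindex_bij_witness[of _ "\<lambda>l. l - 1" "\<lambda>j. j + 1"])
    show "walk_count 1 (int k + 1) (m + r) r 1 (j + 1) = walk_count 0 (int k) (m + r) r 0 j" for j
      using walk_count_shift[of 0 1 "int k" "m + r" r 0 j] by simp
  qed auto
  finally show ?thesis .
qed

lemma card_free_motzkin_paths_eq_card_motzkin_prefixes:
  "card (free_motzkin_paths m r k) = card (motzkin_prefixes m r k)"
proof -
  let ?W = "walk_count 1 (int k + 1) (m + r) r 1"
  have "card (free_motzkin_paths m r k) = (\<Sum>l = 1..2 * int (k div 2 + 1). ?W l)"
    unfolding card_free_motzkin_paths
    using walk_count_central[of "k div 2 + 1" "int k + 1" "m + r" r] by (simp add: algebra_simps)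
  \<comment> \<open>For odd \<open>k\<close> the ranges coincide; for even \<open>k\<close> the
    extra index k + 2 lies above the strip and contributes 0.\<close>
  also have "\<dots> = (\<Sum>l = 1..int k + 1. ?W l)"
  proof (rule sum.mono_neutral_right)
    show "{1..int k + 1} \<subseteq> {1..2 * int (k div 2 + 1)}"
      by auto
  qed (auto simp: walk_count_end_outside)
  finally show ?thesis
    by (simp add: card_motzkin_prefixes)
qed

section \<open>Paths touching the distinguished line\<close>

lemma in_strip_remove_top: "in_strip a b P \<and> \<not> touches_line b P \<longleftrightarrow> in_strip a (b - 1) P"
  by (fastforce simp: in_strip_def touches_line_def)

lemma in_strip_remove_bottom: "in_strip a b P \<and> \<not> touches_line a P \<longleftrightarrow> in_strip (a + 1) b P"
  by (fastforce simp: in_strip_def touches_line_def)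

text \<open>Raising \<open>k\<close> by one widens the strip by one unit on a single side,
  alternating between top and bottom; \<open>L_line\<close> is the edge just added. The inclusion
  lets cardinalities be subtracted.\<close>

lemma free_motzkin_paths_touching_Suc:
  "free_motzkin_paths_touching m r (Suc k) =
     free_motzkin_paths m r (Suc k) - free_motzkin_paths m r k"
  "free_motzkin_paths m r k \<subseteq> free_motzkin_paths m r (Suc k)"
proof -
  have "in_strip (- int (k div 2)) (int ((k + 1) div 2)) P \<longleftrightarrow>
      in_strip (- int (Suc k div 2)) (int ((Suc k + 1) div 2)) P \<and> \<not> touches_line (L_line (Suc k)) P"
    for P
  proof (cases "even k")
    case True
    then have "int ((k + 1) div 2) = int ((Suc k + 1) div 2) - 1" "Suc k div 2 = k div 2"
      "L_line (Suc k) = int ((Suc k + 1) div 2)"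
      by (auto simp: L_line_def)
    then show ?thesis
      by (metis in_strip_remove_top)
  next
    case False
    then have "- int (k div 2) = - int (Suc k div 2) + 1" "(Suc k + 1) div 2 = (k + 1) div 2"
      "L_line (Suc k) = - int (Suc k div 2)"
      by (auto simp: L_line_def elim!: oddE)
    then show ?thesis
      by (metis in_strip_remove_bottom)
  qed
  then show "free_motzkin_paths_touching m r (Suc k) =
      free_motzkin_paths m r (Suc k) - free_motzkin_paths m r k"
    and "free_motzkin_paths m r k \<subseteq> free_motzkin_paths m r (Suc k)"
    by (auto simp: free_motzkin_paths_touching_def free_motzkin_paths_def)
qed

lemma motzkin_prefixes_touching_Suc:
  "motzkin_prefixes_touching m r (Suc k) = motzkin_prefixes m r (Suc k) - motzkin_prefixes m r k"
  "motzkin_prefixes m r k \<subseteq> motzkin_prefixes m r (Suc k)"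
proof -
  have "in_strip 0 (int k) P \<longleftrightarrow> in_strip 0 (int (Suc k)) P \<and> \<not> touches_line (int (Suc k)) P" for P
    using in_strip_remove_top[of 0 "int (Suc k)" P] by simp
  then show "motzkin_prefixes_touching m r (Suc k) = motzkin_prefixes m r (Suc k) - motzkin_prefixes m r k"
    and "motzkin_prefixes m r k \<subseteq> motzkin_prefixes m r (Suc k)"
    by (auto simp: motzkin_prefixes_touching_def motzkin_prefixes_def)
qed

lemma touches_line_strip_0: "in_strip c c P \<Longrightarrow> touches_line c P"
  by (cases "snd P")
    (auto simp: in_strip_def touches_line_def vertices_def start_point_def steps_def)

text \<open>Here no smaller strip exists, but the strip collapses to the distinguished line, which
  the starting vertex already touches.\<close>

lemma touching_0:
  "free_motzkin_paths_touching m r 0 = free_motzkin_paths m r 0"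
  "motzkin_prefixes_touching m r 0 = motzkin_prefixes m r 0"
  by (auto simp: free_motzkin_paths_touching_def free_motzkin_paths_def motzkin_prefixes_touching_def
      motzkin_prefixes_def L_line_def touches_line_strip_0)

theorem theorem1p1:
  fixes m r k :: nat
  shows "\<exists>\<phi>. bij_betw \<phi> (free_motzkin_paths_touching m r k) (motzkin_prefixes_touching m r k)"
proof (rule finite_same_card_bij)
  show "finite (free_motzkin_paths_touching m r k)"
    by (rule finite_subset[OF _ finite_free_motzkin_paths[of m r k]])
      (auto simp: free_motzkin_paths_touching_def)
  show "finite (motzkin_prefixes_touching m r k)"
    by (rule finite_subset[OF _ finite_motzkin_prefixes[of m r k]])
      (auto simp: motzkin_prefixes_touching_def)
  show "card (free_motzkin_paths_touching m r k) = card (motzkin_prefixes_touching m r k)"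
  proof (cases k)
    case 0
    then show ?thesis
      by (simp add: touching_0 card_free_motzkin_paths_eq_card_motzkin_prefixes)
  next
    \<comment> \<open>Both touching families are differences of nested finite families whose
      cardinalities agree at \<open>Suc k'\<close> and at \<open>k'\<close>.\<close>
    case (Suc k')
    then show ?thesis
      by (simp add: free_motzkin_paths_touching_Suc motzkin_prefixes_touching_Suc card_Diff_subset
          finite_free_motzkin_paths finite_motzkin_prefixes
          card_free_motzkin_paths_eq_card_motzkin_prefixes)
  qed
qed

end
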